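(* Let $p \ge 31$ be a prime, let $G$ be a cyclic group of order $p$ (written additively), and let $S$ be a minimal zero-sum sequence over $G$ of length $|S|=5$ with $\mathsf h(S)\ge 2$. Then $\operatorname{ind}(S)\in\{1,2\}$, and $\operatorname{ind}(S)=2$ if and only if $S=g^2\cdot\left(\frac{p-1}{2}g\right)\cdot\left(\frac{p+3}{2}g\right)\cdot\left((p-3)g\right)$ for some $g\in G$.
   Context: Let $G$ be a finite cyclic group written additively. A sequence over $G$ is an element of the free abelian monoid $\mathcal F(G)$ with basis $G$, i.e. a finite multiset of elements of $G$ written multiplicatively; its length $|S|$ is the number of terms counted with multiplicity, and $g^2$ means that the term $g$ is taken twice. $S$ is a zero-sum sequence if the sum of its terms is $0$; it is a minimal zero-sum sequence if in addition no proper nontrivial (nonempty) subsequence has sum $0$. $\mathsf h(S)$ denotes the maximal multiplicity of an element in $S$. Index: for each generator $g$ of $G$ one can write $S=(n_1g)\cdot\ldots\cdot(n_lg)$ with unique $n_1,\ldots,n_l\in[1,\operatorname{ord}(g)]$, and one sets $\|S\|_g=\frac{n_1+\cdots+n_l}{\operatorname{ord}(g)}$; then $\operatorname{ind}(S)=\min\{\|S\|_g : g\in G,\ G=\langle g\rangle\}$. *)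

theory Defs
  imports "HOL-Algebra.Algebra" "HOL-Library.Multiset" "HOL-Computational_Algebra.Primes"
begin

text \<open>
  The additively written group of the source is rendered with the multiplicative notation of
  HOL-Algebra: the sum \<open>a + b\<close> is \<open>a \<otimes>\<^bsub>G\<^esub> b\<close>, the neutral element
  \<open>0\<close> is \<open>\<one>\<^bsub>G\<^esub>\<close>, and the multiple \<open>n g\<close> is
  \<open>g [^]\<^bsub>G\<^esub> n\<close>.  Multiplication in the free abelian monoid of sequences is
  addition of multisets, and subsequences are submultisets.
\<close>

definition sequence_over :: "('a, 'b) monoid_scheme \<Rightarrow> 'a multiset \<Rightarrow> bool" where
  "sequence_over G S \<longleftrightarrow> set_mset S \<subseteq> carrier G"

definition seq_sum :: "('a, 'b) monoid_scheme \<Rightarrow> 'a multiset \<Rightarrow> 'a" where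
  "seq_sum G S = finprod G (\<lambda>g. g [^]\<^bsub>G\<^esub> count S g) (set_mset S)"

definition zero_sum :: "('a, 'b) monoid_scheme \<Rightarrow> 'a multiset \<Rightarrow> bool" where
  "zero_sum G S \<longleftrightarrow> seq_sum G S = \<one>\<^bsub>G\<^esub>"

definition minimal_zero_sum :: "('a, 'b) monoid_scheme \<Rightarrow> 'a multiset \<Rightarrow> bool" where
  "minimal_zero_sum G S \<longleftrightarrow>
     sequence_over G S \<and> zero_sum G S \<and> (\<forall>T. T \<subset># S \<and> T \<noteq> {#} \<longrightarrow> \<not> zero_sum G T)"

text \<open>The maximal multiplicity \<open>h(S)\<close>; meaningful for finite \<open>G\<close>.\<close>

definition max_mult :: "('a, 'b) monoid_scheme \<Rightarrow> 'a multiset \<Rightarrow> nat" where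
  "max_mult G S = Max (count S ` carrier G)"

definition is_generator :: "('a, 'b) monoid_scheme \<Rightarrow> 'a \<Rightarrow> bool" where
  "is_generator G g \<longleftrightarrow> g \<in> carrier G \<and> generate G {g} = carrier G"

text \<open>
  The unique \<open>n \<in> [1, ord g]\<close> with \<open>x = n g\<close>, for a generator \<open>g\<close> of a
  finite group; the neutral element has coordinate \<open>ord g\<close>, not \<open>0\<close>.
\<close>

definition coord :: "('a, 'b) monoid_scheme \<Rightarrow> 'a \<Rightarrow> 'a \<Rightarrow> nat" where
  "coord G g x = (THE n. n \<in> {1..group.ord G g} \<and> x = g [^]\<^bsub>G\<^esub> n)"

definition norm_wrt :: "('a, 'b) monoid_scheme \<Rightarrow> 'a \<Rightarrow> 'a multiset \<Rightarrow> real" where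
  "norm_wrt G g S = real (\<Sum>x\<in>#S. coord G g x) / real (group.ord G g)"

definition seq_index :: "('a, 'b) monoid_scheme \<Rightarrow> 'a multiset \<Rightarrow> real" where
  "seq_index G S = Min {norm_wrt G g S | g. is_generator G g}"

end

theory Submission
  imports Defs
begin

text \<open>
Write a repeated term of \<open>S\<close> as \<open>g\<close>. Then \<open>g\<close> is a generator, and with respect to \<open>g\<close> the
coordinates of \<open>S\<close> are \<open>1, 1, a, b, c\<close>. Minimality gives \<open>1 \<le> a, b, c \<le> p - 3\<close>
(\<open>minimal_zero_sum_coords\<close>). Changing the generator amounts to multiplying all coordinates by
a unit \<open>u\<close> modulo \<open>p\<close> and reducing to \<open>[1, p]\<close>; the sum of the coordinates is always a multiple of
\<open>p\<close>, and the unit \<open>-u\<close> turns a sum \<open>n p\<close> into \<open>(5 - n) p\<close>. So the index is 1 or 2, and it is 1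
exactly when some unit produces the sum \<open>p\<close> (\<open>seq_index_eq\<close>).

It remains to find such a unit, unless \<open>S\<close> is the exceptional sequence. If \<open>2 + a + b + c = p\<close>,
take \<open>u = 1\<close>. Otherwise \<open>x = p - a\<close>, \<open>y = p - b\<close>, \<open>z = p - c\<close> satisfy \<open>x, y, z \<ge> 3\<close> and
\<open>x + y + z = p + 2\<close>, and we may order them as \<open>x \<le> y \<le> z\<close>. If \<open>z < p / 2\<close>, take \<open>u = 2\<close>.
Otherwise \<open>x + y - 2 = p - z\<close> is less than \<open>p / 2\<close>, and an integer \<open>m < p / x\<close> in one of the
intervals \<open>[k p / (x + y - 2), k p / y)\<close> is a suitable unit. The interval has length
\<open>k p (x - 2) / (y (x + y - 2))\<close>. With \<open>k\<close> the integer part of \<open>y / x\<close>, so that every integer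
of the interval is below \<open>p / x\<close>, the length is roughly at least \<open>2 (x - 2) / x\<close>. For \<open>x \<ge> 5\<close> this
exceeds 1 and, apart from \<open>y\<close> just below \<open>2 x\<close> and finitely many \<open>p\<close>, leaves room for
the rounding of \<open>y / x\<close>. The cases \<open>x = 4\<close> and above all \<open>x = 3\<close> are delicate when \<open>y / p\<close> is close to a fraction with a small denominator, namely
\<open>1 / 2\<close> or \<open>1 / 3\<close>, and are settled by an explicit choice of \<open>m\<close> adapted to that fraction
(\<open>multiplier_4\<close>, \<open>multiplier_3\<close>); this needs large \<open>p\<close>, and a finite computation covers the
others. Only \<open>x = 3\<close>, \<open>y = (p - 3) / 2\<close> fails, and this is the exceptional sequence. A short divisibility argument shows that no unit works for it
(\<open>exceptional_no_unit_sum\<close>).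
\<close>

section \<open>Integers in the intervals between kp/(x+y-2) and kp/y\<close>

text \<open>
  For such \<open>m\<close> and \<open>k\<close> the residues modulo \<open>p\<close> of \<open>-m x\<close>, \<open>-m y\<close> and
  \<open>m (x + y - 2)\<close> are \<open>p - m x\<close>, \<open>k p - m y\<close> and \<open>m (x + y - 2) - k p\<close>. Together with
  \<open>2 m\<close> they add up to \<open>p\<close>, so that multiplication by \<open>m\<close> turns the coordinates
  \<open>1, 1, -x, -y, x + y - 2\<close> into coordinates with sum \<open>p\<close>. The inequalities say that the
  interval \<open>[k p / (x + y - 2), k p / y)\<close> contains an integer \<open>m\<close> below \<open>p / x\<close>.
\<close>

definition admits_multiplier :: "int \<Rightarrow> int \<Rightarrow> int \<Rightarrow> bool" where
  "admits_multiplier p x y \<longleftrightarrow>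
     (\<exists>m k. 0 < m \<and> m * x < p \<and> m * y < k * p \<and> k * p \<le> m * (x + y - 2))"

lemma admits_multiplierI:
  "0 < m \<Longrightarrow> m * x < p \<Longrightarrow> m * y < k * p \<Longrightarrow> k * p \<le> m * (x + y - 2) \<Longrightarrow> admits_multiplier p x y"
  by (auto simp: admits_multiplier_def)

text \<open>
  The hypothesis on the product says that the interval \<open>[k p / (x + y - 2), k p / y)\<close> has
  length at least 1. It therefore contains an integer, for example the last one before
  \<open>k p / y\<close>; and \<open>k p / y\<close> does not exceed \<open>p / x\<close> as \<open>k x \<le> y\<close>.
\<close>

lemma multiplier_of_long_interval:
  fixes p x y k :: int
  assumes "0 < p" "3 \<le> x" "0 < k" "k * x \<le> y" and len: "y * (x + y - 2) \<le> k * p * (x - 2)"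
    and "y < p"
  shows "admits_multiplier p x y"
proof (rule admits_multiplierI)
  define m where "m = (k * p - 1) div y"
  have "0 < k * x" using assms by simp
  then have y: "0 < y" using assms(4) by linarith
  have m1: "m * y < k * p" and m2: "k * p \<le> (m + 1) * y"
    using y div_mult_mod_eq[of "k * p - 1" y] pos_mod_bound[of y "k * p - 1"]
      pos_mod_sign[of y "k * p - 1"]
    unfolding m_def distrib_right by linarith+
  show "m * y < k * p" by (fact m1)
  have "1 * p \<le> k * p" using assms by (intro mult_right_mono) auto
  then have "y < k * p" using assms by linarith
  then show "0 < m" unfolding m_def using y by (simp add: pos_imp_zdiv_pos_iff)
  have "k * (m * x) = m * (k * x)" by (simp add: algebra_simps)
  also have "\<dots> \<le> m * y" using assms \<open>0 < m\<close> by (intro mult_left_mono) auto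
  also have "\<dots> < k * p" by (fact m1)
  finally show "m * x < p" using \<open>0 < k\<close> by simp
  have "y * (k * p) \<le> (k * p - y) * (x + y - 2)"
    using len by (simp add: algebra_simps)
  also have "\<dots> \<le> (m * y) * (x + y - 2)"
    using m2 assms y by (intro mult_right_mono) (auto simp: algebra_simps)
  also have "\<dots> = y * (m * (x + y - 2))" by (simp add: algebra_simps)
  finally show "k * p \<le> m * (x + y - 2)" using y by simp
qed

text \<open>
  Because of \<open>p > 2 (x + y - 2)\<close>, the length \<open>k p (x - 2) / (y (x + y - 2))\<close> of the interval
  exceeds \<open>2 k (x - 2) / y\<close>, and this is at least 1 if and only if \<open>r \<le> k (x - 4)\<close>.
\<close>

lemma multiplier_of_small_remainder:
  fixes p x k r :: int
  assumes "3 \<le> x" "0 < k" "0 \<le> r" and r: "r \<le> k * (x - 4)"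
    and y: "y = k * x + r" "2 * (x + y - 2) < p"
  shows "admits_multiplier p x y"
proof (rule multiplier_of_long_interval[where k = k])
  have kx: "x \<le> k * x" using assms mult_right_mono[of 1 k x] by simp
  then have xy: "0 < x + y - 2" using assms by linarith
  then show "0 < p" "y < p" using \<open>3 \<le> x\<close> y(2) by auto
  have "y \<le> 2 * k * (x - 2)"
    using r y by (simp add: algebra_simps)
  then have "y * (x + y - 2) \<le> (2 * k * (x - 2)) * (x + y - 2)"
    using xy by (intro mult_right_mono) auto
  also have "\<dots> = (k * (x - 2)) * (2 * (x + y - 2))" by (simp add: algebra_simps)
  also have "\<dots> \<le> (k * (x - 2)) * p" using assms by (intro mult_left_mono) auto
  finally show "y * (x + y - 2) \<le> k * p * (x - 2)" by (simp add: algebra_simps)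
qed (use assms in auto)

text \<open>
  For a quotient \<open>k \<ge> 2\<close> every remainder below \<open>x\<close> is at most \<open>k (x - 4)\<close>. So only
  \<open>y\<close> just below \<open>2 x\<close> is left. There the interval for \<open>k = 1\<close> has length at least 1 if
  \<open>3 (x + y - 2) < p\<close>, and contains 3 if \<open>3 y < p \<le> 3 (x + y - 2)\<close>; if \<open>p < 3 y\<close>, the interval
  for \<open>k = 2\<close> contains 5. The divisibility hypotheses exclude \<open>p = 3 y\<close> and, in the last case,
  \<open>p = 35\<close>, where 5 is too large.
\<close>

lemma multiplier_ge_7:
  fixes p x y :: int
  assumes "7 \<le> x" "x \<le> y" "2 * (x + y - 2) < p" "\<not> 3 dvd p" "\<not> 5 dvd p"
  shows "admits_multiplier p x y"
proof -
  obtain k r where kr: "y = k * x + r" "0 \<le> r" "r < x" "0 < k"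
  proof
    show "y = (y div x) * x + y mod x" by simp
    show "0 < y div x" using assms by (simp add: pos_imp_zdiv_pos_iff)
  qed (use assms in auto)
  show ?thesis
  proof (cases "r \<le> k * (x - 4)")
    case True
    then show ?thesis using assms kr by (intro multiplier_of_small_remainder[of x k r]) auto
  next
    case False
    have "k = 1"
    proof (rule ccontr)
      assume "k \<noteq> 1"
      then have "2 * (x - 4) \<le> k * (x - 4)" using assms kr by (intro mult_right_mono) auto
      moreover have "r \<le> 2 * (x - 4)" using kr(3) \<open>7 \<le> x\<close> by simp
      ultimately show False using False by simp
    qed
    with kr False have y: "2 * x - 3 \<le> y" "y < 2 * x" by auto
    consider "p \<le> 3 * (x + y - 2)" "3 * y < p" | "3 * (x + y - 2) < p" | "p < 3 * y"
      using assms by force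
    then show ?thesis
    proof cases
      case 1
      then show ?thesis using assms y by (intro admits_multiplierI[where m = 3 and k = 1]) auto
    next
      case 2
      have "y * (x + y - 2) \<le> (3 * (x - 2)) * (x + y - 2)"
        using assms y by (intro mult_right_mono) auto
      also have "\<dots> = (3 * (x + y - 2)) * (x - 2)" by (simp only: mult_ac)
      also have "\<dots> \<le> p * (x - 2)" using assms 2 by (intro mult_right_mono) auto
      finally show ?thesis using assms by (intro multiplier_of_long_interval[where k = 1]) auto
    next
      case 3
      have "p \<noteq> 35" using assms(5) by auto
      have "y = 2 * x - 3 \<or> y = 2 * x - 2 \<or> y = 2 * x - 1" using y by linarith
      then have "5 * x < p \<and> 5 * y < 2 * p \<and> 2 * p \<le> 5 * (x + y - 2)"
      proof (elim disjE)
        assume "y = 2 * x - 3"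
        then show ?thesis using 3 assms(3) by simp
      next
        assume y: "y = 2 * x - 2"
        then have p: "p = 6 * x - 7" using 3 assms(3) by simp
        then have "x \<noteq> 7" using \<open>p \<noteq> 35\<close> by auto
        then have "8 \<le> x" using assms(1) by simp
        then show ?thesis unfolding y p by simp
      next
        assume y: "y = 2 * x - 1"
        then have "6 * x - 5 \<le> p" "p \<le> 6 * x - 4" using 3 assms(3) by simp_all
        then show ?thesis unfolding y using assms(1) by simp
      qed
      then show ?thesis by (intro admits_multiplierI[where m = 5 and k = 2]) simp_all
    qed
  qed
qed

text \<open>
  For \<open>x = 3\<close> the intervals are \<open>[k p / (y + 1), k p / y)\<close>, and \<open>m\<close> has to stay below
  \<open>p / 3\<close>. If \<open>y\<close> is clearly smaller than \<open>p / 3\<close>, the interval for the largest admissible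
  \<open>k\<close> has length at least 1. If \<open>y\<close> is clearly larger, \<open>y / p\<close> is better compared with
  \<open>1 / 2\<close>: put \<open>p = 2 y + s\<close> and \<open>m = 2 k + t\<close>; the conditions then read
  \<open>t y < k s \<le> t y + m\<close>, so that the first \<open>k\<close> with \<open>t y < k s\<close> works as soon as
  \<open>s \<le> m\<close>. If \<open>y\<close> is close to \<open>p / 3\<close>, the intervals are followed along a residue class
  of \<open>m\<close> modulo 3, in which \<open>m y\<close> modulo \<open>p\<close> moves in steps of length \<open>\<bar>3 y - p\<bar>\<close>.
\<close>

lemma multiplier_3:
  fixes p y :: int
  assumes p: "107 \<le> p" "odd p" "\<not> 3 dvd p" and y: "3 \<le> y" "2 * y + 5 \<le> p"
  shows "admits_multiplier p 3 y"
proof -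
  consider (small) "3 * y + 10 \<le> p" | (large) "p + 10 \<le> 3 * y"
    | (below) "3 * y < p" "p < 3 * y + 10" | (above) "p < 3 * y" "3 * y < p + 10"
    using p by (metis dvd_triv_left not_le linorder_cases)
  then show ?thesis
  proof cases
    case small
    define k where "k = y div 3"
    have k: "0 < k" "k * 3 \<le> y" "y - 2 \<le> 3 * k" using y by (auto simp: k_def)
    have "3 * (y * (y + 1)) \<le> (y - 2) * p"
    proof (cases "20 \<le> y")
      case True
      have "(y - 2) * (3 * y + 10) \<le> (y - 2) * p" using small y by (intro mult_left_mono) auto
      then show ?thesis using True by (simp add: algebra_simps)
    next
      case False
      have "(y - 2) * 107 \<le> (y - 2) * p" using p y by (intro mult_left_mono) auto
      moreover have "0 \<le> (y - 3) * (20 - y)" using False y by (intro mult_nonneg_nonneg) auto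
      ultimately show ?thesis using y False by (simp add: algebra_simps)
    qed
    also have "\<dots> \<le> (3 * k) * p" using k p by (intro mult_right_mono) auto
    finally show ?thesis using k p y
      by (intro multiplier_of_long_interval[where k = k]) (auto simp: algebra_simps)
  next
    case large
    \<comment> \<open>As \<open>m\<close> is about \<open>t p / s\<close>, this is the smallest \<open>t\<close> that ensures \<open>s < m\<close>;
      the rest of the case is the verification that \<open>3 m\<close> still stays below \<open>p\<close>.\<close>
    define s where "s = p - 2 * y"
    define t where "t = s * s div p + 1"
    define k where "k = t * y div s + 1"
    have s: "5 \<le> s" "3 * s \<le> p - 20" "p = 2 * y + s" using y large by (auto simp: s_def)
    have t: "s * s < t * p" "t * p \<le> s * s + p"
      using p div_mult_mod_eq[of "s * s" p] pos_mod_bound[of p "s * s"] pos_mod_sign[of p "s * s"]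
      unfolding t_def distrib_right by linarith+
    have k: "t * y < k * s" "k * s \<le> t * y + s"
      using s div_mult_mod_eq[of "t * y" s] pos_mod_bound[of s "t * y"] pos_mod_sign[of s "t * y"]
      unfolding k_def distrib_right by linarith+
    have "s * s < s * (2 * k + t)"
      using t k s by (simp add: algebra_simps)
    then have sm: "s < 2 * k + t" using s by simp
    \<comment> \<open>The quadratic inequality \<open>3 s\<^sup>2 + 6 s + 3 p < s p\<close> for \<open>s\<close> holds between 5 and \<open>(p - 20) / 3\<close> by convexity.\<close>
    have "0 \<le> (s - 5) * (p - 20 - 3 * s)" using s by (intro mult_nonneg_nonneg) auto
    then have "3 * (s * s) + 6 * s + 3 * p < s * p" using s p by (simp add: algebra_simps)
    moreover have "s * (2 * k + t) \<le> t * p + 2 * s"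
      using k s by (simp add: algebra_simps)
    ultimately have "s * (3 * (2 * k + t)) < s * p" using t by (simp add: algebra_simps)
    then have "3 * (2 * k + t) < p" using s by simp
    then show ?thesis using k s sm
      by (intro admits_multiplierI[where m = "2 * k + t" and k = k]) (auto simp: algebra_simps)
  next
    case below
    define h where "h = p - 3 * y"
    have h: "1 \<le> h" "h \<le> 9" "p = 3 * y + h" using below by (auto simp: h_def)
    show ?thesis
    proof (cases "h \<le> 3")
      case True
      then show ?thesis using h p by (intro admits_multiplierI[where m = 3 and k = 1]) auto
    next
      case False
      \<comment> \<open>For \<open>m = 3 q + 1\<close> and \<open>k = q\<close>, \<open>k p - m y = q h - y\<close>. The least \<open>q\<close> that makes
        this positive keeps it at most \<open>m\<close>.\<close>
      define q where "q = y div h + 1"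
      have "h \<in> {4,5,6,7,8,9}" using h False by auto
      then have "y < q * h" "q * (h - 3) \<le> y + 1" "9 * q + 3 < p" "0 < q"
        using h p by (auto simp: q_def)
      then show ?thesis using h
        by (intro admits_multiplierI[where m = "3 * q + 1" and k = q]) (auto simp: algebra_simps)
    qed
  next
    case above
    define f where "f = 3 * y - p"
    have f: "1 \<le> f" "f \<le> 9" "p = 3 * y - f" using above by (auto simp: f_def)
    \<comment> \<open>For \<open>m = 3 q - 1\<close> and \<open>k = q\<close>, \<open>k p - m y = y - q f\<close>. The least \<open>q\<close> for which
      this is at most \<open>m\<close> keeps it positive.\<close>
    define q where "q = (y + f + 3) div (f + 3)"
    have "f \<in> {1,2,3,4,5,6,7,8,9}" using f by auto
    then have "q * f < y" "y + 1 \<le> q * (f + 3)" "9 * q - 3 < p" "0 < q"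
      using f p by (auto simp: q_def)
    moreover have qp: "q * p = 3 * (q * y) - q * f"
      unfolding f(3) by (simp add: algebra_simps)
    ultimately show ?thesis using f(1)
      by (intro admits_multiplierI[where m = "3 * q - 1" and k = q]) (auto simp: qp algebra_simps)
  qed
qed

text \<open>
  Put \<open>p = 2 y + s\<close>. For large \<open>s\<close> the largest \<open>k\<close> with \<open>4 k \<le> y\<close> has an interval of length
  at least 1. For \<open>s \<le> 15\<close>, where \<open>y / p\<close> is close to
  \<open>1 / 2\<close>, the choice \<open>m = 2 k + 1\<close> turns the conditions into
  \<open>y < k s \<le> y + 2 m\<close>, and the first \<open>k\<close> with \<open>y < k s\<close> satisfies them.
\<close>

lemma multiplier_4:
  fixes p y :: int
  assumes p: "107 \<le> p" "odd p" and y: "4 \<le> y" "2 * y + 5 \<le> p"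
  shows "admits_multiplier p 4 y"
proof -
  define s where "s = p - 2 * y"
  have s: "5 \<le> s" "p = 2 * y + s" using y by (auto simp: s_def)
  have "odd s" using p by (simp add: s_def)
  show ?thesis
  proof (cases "17 \<le> s")
    case True
    define k where "k = y div 4"
    have k: "0 < k" "k * 4 \<le> y" "y - 3 \<le> 4 * k" using y by (auto simp: k_def)
    have "y * (y + 2) \<le> k * p * 2"
    proof (cases "8 \<le> y")
      case True
      have "0 \<le> (y - 8) * (s - 17)" using True \<open>17 \<le> s\<close> by (intro mult_nonneg_nonneg) auto
      then have "2 * (y * (y + 2)) \<le> (y - 3) * p"
        using True \<open>17 \<le> s\<close> s by (simp add: algebra_simps)
      also have "\<dots> \<le> (4 * k) * p" using k p by (intro mult_right_mono) auto
      finally show ?thesis by simp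
    next
      case False
      then have "y * (y + 2) \<le> 7 * 9" using y by (intro mult_mono) auto
      moreover have "1 * p \<le> k * p" using k p by (intro mult_right_mono) auto
      ultimately show ?thesis using p by linarith
    qed
    then show ?thesis using k p y
      by (intro multiplier_of_long_interval[where k = k]) (auto simp: algebra_simps)
  next
    case False
    \<comment> \<open>Since \<open>y \<ge> 46\<close> and \<open>s \<le> 15\<close>, the quotient \<open>d\<close> of \<open>y\<close> by \<open>s\<close> is at least 3, which gives
      \<open>s \<le> 15 \<le> 2 m\<close> for \<open>m = 2 (d + 1) + 1\<close>.\<close>
    have "s \<noteq> 16" using \<open>odd s\<close> by auto
    then have s15: "s \<le> 15" using False by linarith
    obtain d r where d: "y = d * s + r" "0 \<le> r" "r < s"
    proof
      show "y = (y div s) * s + y mod s" by simp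
    qed (use s in auto)
    have d3: "3 \<le> d"
    proof (rule ccontr)
      assume "\<not> 3 \<le> d"
      then have "d * s \<le> 2 * 15" using s15 s by (intro mult_mono) auto
      then show False using d p s(2) s15 by linarith
    qed
    define k where "k = d + 1"
    have ks: "k * s = d * s + s" by (simp add: k_def algebra_simps)
    have "d * 5 \<le> d * s" using s d3 by (intro mult_left_mono) auto
    \<comment> \<open>A name for the product keeps the simplifier from cancelling \<open>d\<close> in \<open>d * 5 \<le> d * s\<close>.\<close>
    then obtain e where e: "e = d * s" "5 * d \<le> e" by (simp only: mult.commute)
    then have "y < k * s" "k * s \<le> y + 4 * k + 2" "4 * (2 * k + 1) < p" "0 < k"
      using d3 p s15 s d unfolding ks e(1)[symmetric] by (simp_all add: k_def)
    then show ?thesis using s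
      by (intro admits_multiplierI[where m = "2 * k + 1" and k = k]) (auto simp: algebra_simps)
  qed
qed

text \<open>
  The remainder of \<open>y\<close> modulo \<open>x\<close> is at most 4 or 5, and from \<open>y = 20\<close> on the quotient is large
  enough for the remainder to be harmless. For smaller \<open>y\<close> the interval has length at least 1
  already for \<open>p = 47\<close>, hence for every larger \<open>p\<close>.
\<close>

lemma multiplier_5_6:
  fixes p x y :: int
  assumes "47 \<le> p" and x: "x = 5 \<or> x = 6" and y: "x \<le> y" "2 * (x + y - 2) < p"
  shows "admits_multiplier p x y"
proof (cases "20 \<le> y")
  case True
  then have "y mod x \<le> (y div x) * (x - 4)" "0 < y div x" "0 \<le> y mod x" using x by auto
  then show ?thesis using x y
    by (intro multiplier_of_small_remainder[of x "y div x" "y mod x"]) auto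
next
  case False
  have "\<forall>x \<in> set [5, 6]. \<forall>y \<in> set [x..19]. y * (x + y - 2) \<le> (y div x) * 47 * (x - 2)"
    by code_simp
  then have "y * (x + y - 2) \<le> (y div x) * 47 * (x - 2)"
    using False x y(1) unfolding set_upto by (elim disjE) (auto simp: algebra_simps)
  also have "\<dots> \<le> (y div x) * p * (x - 2)"
    using assms by (intro mult_right_mono mult_left_mono) (auto simp: pos_imp_zdiv_nonneg_iff)
  finally show ?thesis using assms
    by (intro multiplier_of_long_interval[where k = "y div x"]) (auto simp: pos_imp_zdiv_pos_iff)
qed

text \<open>
  The general arguments need \<open>p\<close> to be large when \<open>x \<le> 6\<close>. This is the finite remainder, where
  only the last integer before \<open>k p / y\<close> has to be tried for each \<open>k\<close>. The bound for \<open>k\<close> goes one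
  beyond the integer part of \<open>y / x\<close>, since \<open>p = 31\<close>, \<open>x = 6\<close>, \<open>y = 11\<close> requires \<open>m = 5\<close> and
  \<open>k = 2\<close>. Coprimality to 30 replaces primality, as it can be tested by remainders.
\<close>

lemma multiplier_small_check:
  "\<forall>p \<in> set [31..106]. p mod 2 = 1 \<and> p mod 3 \<noteq> 0 \<and> p mod 5 \<noteq> 0 \<longrightarrow>
    (\<forall>x \<in> set [3..(if p < 47 then 6 else 4)]. \<forall>y \<in> set [x..(p + 3) div 2 - x].
      x = 3 \<and> 2 * y = p - 3 \<or>
      (\<exists>k \<in> set [1..y div x + 1]. let m = (k * p - 1) div y in
         m * x < p \<and> k * p \<le> m * (x + y - 2)))"
  by code_simp

lemma multiplier_small:
  fixes p x y :: int
  assumes p: "31 \<le> p" "p < 107" "odd p" "\<not> 3 dvd p" "\<not> 5 dvd p"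
    and x: "3 \<le> x" "x \<le> (if p < 47 then 6 else 4)" and y: "x \<le> y" "2 * (x + y - 2) < p"
    and ne: "\<not> (x = 3 \<and> 2 * y = p - 3)"
  shows "admits_multiplier p x y"
proof -
  have "p \<in> {31..106}" "p mod 2 = 1 \<and> p mod 3 \<noteq> 0 \<and> p mod 5 \<noteq> 0"
    using p by (simp_all add: odd_iff_mod_2_eq_one dvd_eq_mod_eq_0)
  moreover have "x \<in> {3..(if p < 47 then 6 else 4)}" "y \<in> {x..(p + 3) div 2 - x}"
    using x y by simp_all
  ultimately obtain k where
    "1 \<le> k" "(k * p - 1) div y * x < p" "k * p \<le> (k * p - 1) div y * (x + y - 2)"
    using multiplier_small_check[unfolded set_upto Let_def] ne by (meson atLeastAtMost_iff)
  moreover have "(k * p - 1) div y * y < k * p"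
    using x y div_mult_mod_eq[of "k * p - 1" y] pos_mod_sign[of y "k * p - 1"] by linarith
  moreover have "0 < (k * p - 1) div y"
  proof -
    have "1 * p \<le> k * p" using p \<open>1 \<le> k\<close> by (intro mult_right_mono) auto
    moreover have "0 < y" "y < p" using x(1) y by simp_all
    ultimately have "y \<le> k * p - 1" by linarith
    then show ?thesis using \<open>0 < y\<close> by (simp only: pos_imp_zdiv_pos_iff)
  qed
  ultimately show ?thesis by (intro admits_multiplierI)
qed

text \<open>
  The excluded pair is a genuine exception: for \<open>x = 3\<close> and \<open>p = 2 y + 3\<close> the conditions on
  \<open>m = 2 k + t\<close> become \<open>t y < 3 k\<close> and \<open>3 k \<le> t y + m\<close>, and the first of them forces
  \<open>t p < 3 m < p\<close>, so \<open>t \<le> 0\<close>, whence \<open>3 k \<le> m \<le> 2 k\<close>.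
\<close>

lemma multiplier_exists:
  fixes p x y :: int
  assumes p: "31 \<le> p" "odd p" "\<not> 3 dvd p" "\<not> 5 dvd p"
    and xy: "3 \<le> x" "x \<le> y" "2 * (x + y - 2) < p" and ne: "\<not> (x = 3 \<and> 2 * y = p - 3)"
  shows "admits_multiplier p x y"
proof -
  consider "7 \<le> x" | "x = 5 \<or> x = 6" | "x = 4" | "x = 3" using xy(1) by linarith
  then show ?thesis
  proof cases
    case 1
    then show ?thesis using multiplier_ge_7 p xy by blast
  next
    case 2
    then show ?thesis
      using multiplier_5_6[of p x y] multiplier_small[of p x y] p xy by (cases "47 \<le> p") auto
  next
    case 3
    show ?thesis
    proof (cases "107 \<le> p")
      case True
      have "2 * y + 5 \<le> p" using 3 xy by simp
      then show ?thesis using True 3 multiplier_4[of p y] p xy by simp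
    next
      case False
      then show ?thesis using 3 multiplier_small[of p x y] p xy by simp
    qed
  next
    case 4
    show ?thesis
    proof (cases "107 \<le> p")
      case True
      have "p \<noteq> 2 * y + 3" "p \<noteq> 2 * y + 4" "2 * y + 2 < p" using 4 xy ne p(2) by auto
      then have "2 * y + 5 \<le> p" by linarith
      then show ?thesis using True 4 multiplier_3[of p y] p xy by simp
    next
      case False
      then show ?thesis using 4 ne multiplier_small[of p x y] p xy by simp
    qed
  qed
qed

section \<open>Multiplying the coordinates by a unit\<close>

text \<open>
  If \<open>x, y, z < p / 2\<close>, doubling works: \<open>4 + (p - 2 x) + (p - 2 y) + (p - 2 z) = p\<close>.
  Otherwise \<open>p - z = x + y - 2\<close> is below \<open>p / 2\<close> and the previous section applies. In both cases
  the residues of \<open>-u x, -u y, -u z\<close> are recognised by a common argument: they are nonnegative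
  representatives whose sum \<open>p - 2 u\<close> is below \<open>p\<close>.
\<close>

lemma unit_sum_of_sorted:
  fixes p x y z :: int
  assumes p: "31 \<le> p" "odd p" "\<not> 3 dvd p" "\<not> 5 dvd p"
    and xyz: "3 \<le> x" "x \<le> y" "y \<le> z" "x + y + z = p + 2"
    and ne: "\<not> (x = 3 \<and> 2 * y = p - 3)"
  shows "\<exists>u>0. 2 * u + (u * (p - x)) mod p + (u * (p - y)) mod p + (u * (p - z)) mod p = p"
proof -
  have *: "2 * u + (u * (p - x)) mod p + (u * (p - y)) mod p + (u * (p - z)) mod p = p"
    if "0 < u" "0 \<le> i * p - u * x" "0 \<le> j * p - u * y" "0 \<le> l * p - u * z" "i + j + l = u + 1"
    for u i j l
  proof -
    have residue: "(u * (p - t)) mod p = n * p - u * t" if "0 \<le> n * p - u * t" "n * p - u * t < p" for n t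
    proof -
      have "u * (p - t) = (n * p - u * t) + p * (u - n)" by (simp add: algebra_simps)
      then have "(u * (p - t)) mod p = (n * p - u * t) mod p" by simp
      then show ?thesis using that by simp
    qed
    have "(i * p - u * x) + (j * p - u * y) + (l * p - u * z) = (i + j + l) * p - u * (x + y + z)"
      by (simp add: algebra_simps)
    also have "\<dots> = p - 2 * u" unfolding that(5) xyz(4) by (simp add: algebra_simps)
    finally have sum: "(i * p - u * x) + (j * p - u * y) + (l * p - u * z) = p - 2 * u" .
    then have "i * p - u * x < p" "j * p - u * y < p" "l * p - u * z < p"
      using that(1-4) by linarith+
    then show ?thesis using residue that(2-4) sum by simp
  qed
  show ?thesis
  proof (cases "2 * z < p")
    case True
    then show ?thesis using xyz by (intro exI[of _ 2] conjI *[of 2 1 1 1]) auto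
  next
    case False
    then have "2 * (x + y - 2) < p" using xyz(4) p(2) by (cases "2 * z = p") auto
    then obtain m k where m: "0 < m" "m * x < p" "m * y < k * p" "k * p \<le> m * (x + y - 2)"
      using multiplier_exists[OF p xyz(1,2) _ ne] by (auto simp: admits_multiplier_def)
    have "x + y - 2 = p - z" using xyz(4) by simp
    with m(4) have "k * p \<le> m * (p - z)" by simp
    then show ?thesis using m by (intro exI[of _ m] conjI *[of m 1 k "m - k"]) (auto simp: algebra_simps)
  qed
qed

text \<open>
  The sum \<open>2 + a + b + c\<close> is \<open>p\<close> or \<open>2 p\<close>. In the first case the multiplier 1 works; in the
  second one the numbers \<open>p - a, p - b, p - c\<close> are at least 3 and have sum \<open>p + 2\<close>.
\<close>

lemma unit_sum_exists:
  fixes p a b c :: nat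
  assumes p: "Factorial_Ring.prime p" "31 \<le> p"
    and abc: "1 \<le> a" "a \<le> p - 3" "1 \<le> b" "b \<le> p - 3" "1 \<le> c" "c \<le> p - 3"
    and dvd: "p dvd 2 + a + b + c"
    and ne: "{#a, b, c#} \<noteq> {#(p - 1) div 2, (p + 3) div 2, p - 3#}"
  shows "\<exists>u>0. 2 * u + (u * a) mod p + (u * b) mod p + (u * c) mod p = p"
proof -
  obtain q where q: "2 + a + b + c = p * q" using dvd by (elim dvdE)
  have "q \<noteq> 0"
  proof
    assume "q = 0"
    then show False using q by simp
  qed
  moreover have "q < 3"
  proof (rule ccontr)
    assume "\<not> q < 3"
    then have "p * 3 \<le> p * q" by (intro mult_left_mono) auto
    then show False using q abc p(2) by linarith
  qed
  ultimately consider "2 + a + b + c = p" | "2 + a + b + c = 2 * p" using q by (cases "q = 1") auto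
  then show ?thesis
  proof cases
    case 1
    then show ?thesis by (intro exI[of _ 1]) auto
  next
    case 2
    have nd: "\<not> 2 dvd p" "\<not> 3 dvd p" "\<not> 5 dvd p"
      using p prime_nat_iff[of p] by (auto dest!: spec)
    have p': "31 \<le> int p" "odd (int p)" "\<not> 3 dvd int p" "\<not> 5 dvd int p"
      using p(2) nd int_dvd_int_iff[of 3 p] int_dvd_int_iff[of 5 p] by auto
    define x y z where "x = int p - int a" and "y = int p - int b" and "z = int p - int c"
    have xyz: "3 \<le> x" "3 \<le> y" "3 \<le> z" "x + y + z = int p + 2"
      using abc 2 p(2) by (auto simp: x_def y_def z_def)
    let ?ex = "{#3, (int p - 3) div 2, (int p + 1) div 2#}"
    have "{#x, y, z#} \<noteq> ?ex"
    proof
      assume eq: "{#x, y, z#} = ?ex"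
      obtain h where h: "p = 2 * h + 1" using nd(1) by (elim oddE)
      have "{#a, b, c#} = image_mset (\<lambda>t. nat (int p - t)) {#x, y, z#}"
        by (simp add: x_def y_def z_def)
      also have "\<dots> = {#(p - 1) div 2, (p + 3) div 2, p - 3#}"
      proof -
        have "nat (int p - 3) = p - 3" "nat (int p - (int p - 3) div 2) = (p + 3) div 2"
          "nat (int p - (int p + 1) div 2) = (p - 1) div 2"
          using p(2) by (simp_all add: h)
        then show ?thesis unfolding eq by (simp add: add_mset_commute)
      qed
      finally show False using ne by simp
    qed
    moreover have "{#3, s, r#} = ?ex" if "2 * s = int p - 3" "s + r = int p - 1" for s r
    proof -
      have "s = (int p - 3) div 2" "r = (int p + 1) div 2" using that by simp_all
      then show ?thesis by simp
    qed
    ultimately have *: "\<not> (t = 3 \<and> 2 * s = int p - 3)"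
      if "{#t, s, r#} = {#x, y, z#}" "t + s + r = int p + 2" for t s r
      using that by force
    have ne': "\<not> (x = 3 \<and> 2 * y = int p - 3)" "\<not> (x = 3 \<and> 2 * z = int p - 3)"
      "\<not> (y = 3 \<and> 2 * x = int p - 3)" "\<not> (y = 3 \<and> 2 * z = int p - 3)"
      "\<not> (z = 3 \<and> 2 * x = int p - 3)" "\<not> (z = 3 \<and> 2 * y = int p - 3)"
      by (rule *[of _ _ z] *[of _ _ y] *[of _ _ x]; use xyz(4) in \<open>simp add: add_mset_commute\<close>)+
    have "\<exists>u>0. 2 * u + (u * int a) mod int p + (u * int b) mod int p + (u * int c) mod int p = int p"
    proof -
      consider "x \<le> y" "y \<le> z" | "x \<le> z" "z \<le> y" | "y \<le> x" "x \<le> z" | "y \<le> z" "z \<le> x"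
        | "z \<le> x" "x \<le> y" | "z \<le> y" "y \<le> x" by linarith
      then show ?thesis
        using unit_sum_of_sorted[OF p', of x y z] unit_sum_of_sorted[OF p', of x z y]
          unit_sum_of_sorted[OF p', of y x z] unit_sum_of_sorted[OF p', of y z x]
          unit_sum_of_sorted[OF p', of z x y] unit_sum_of_sorted[OF p', of z y x] xyz ne'
        by cases (simp_all add: x_def y_def z_def ac_simps)
    qed
    then obtain u where u: "0 < u"
      "2 * u + (u * int a) mod int p + (u * int b) mod int p + (u * int c) mod int p = int p" by blast
    obtain n where n: "u = int n" using u(1) by (metis nonneg_int_cases less_imp_le)
    then have "int (2 * n + (n * a) mod p + (n * b) mod p + (n * c) mod p) = int p"
      using u(2) by (simp add: zmod_int)
    then show ?thesis using u(1) n by (intro exI[of _ n]) linarith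
  qed
qed

text \<open>
  Since \<open>2 u + A + B + C = p\<close>, both \<open>2 A + u\<close> and \<open>C + 3 u\<close> lie strictly between 0 and \<open>2 p\<close>.
  As multiples of \<open>p\<close> they are equal to \<open>p\<close>, and then \<open>2 B = 3 u - p = - C\<close> is negative.
\<close>

lemma exceptional_no_unit_sum:
  fixes p u A B C :: int
  assumes pos: "0 < u" "0 < A" "0 < B" "0 < C" and sum: "2 * u + A + B + C = p" and "odd p"
    and A: "p dvd A - u * ((p - 1) div 2)" and C: "p dvd C - u * (p - 3)"
  shows False
proof -
  have eq: "t = p" if t: "p dvd t" "0 < t" "t < 2 * p" for t
  proof -
    obtain q where "t = p * q" using t(1) by (rule dvdE)
    moreover have "0 < p" using pos sum by linarith
    ultimately have "0 < q" "q < 2" using t by (auto simp: zero_less_mult_iff mult.commute)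
    then show ?thesis using \<open>t = p * q\<close> by simp
  qed
  have "p dvd 2 * (A - u * ((p - 1) div 2)) + u * p" using A by (intro dvd_add dvd_mult) auto
  also have "2 * (A - u * ((p - 1) div 2)) + u * p = 2 * A + u"
    using \<open>odd p\<close> by (elim oddE) (simp add: algebra_simps)
  finally have 1: "2 * A + u = p" using pos sum by (intro eq) auto
  have "p dvd (C - u * (p - 3)) + u * p" using C by (intro dvd_add) auto
  also have "(C - u * (p - 3)) + u * p = C + 3 * u" by (simp add: algebra_simps)
  finally have 2: "C + 3 * u = p" using pos sum by (intro eq) auto
  show False using 1 2 pos sum by linarith
qed

section \<open>Coordinates in groups of prime order\<close>

locale prime_order_group = comm_group G for G (structure) +
  fixes p :: nat
  assumes prime_p: "Factorial_Ring.prime p" and order_G: "order G = p"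
begin

lemma finite_carrier: "finite (carrier G)"
  using prime_gt_0_nat[OF prime_p] by (simp flip: order_gt_0_iff_finite add: order_G)

lemma ord_eq_p:
  assumes "x \<in> carrier G" "x \<noteq> \<one>"
  shows "ord x = p"
  using ord_dvd_group_order[OF assms(1)] ord_eq_1[OF assms(1)] assms(2) order_G prime_p
  by (metis prime_nat_iff)

lemma is_generator_iff: "is_generator G h \<longleftrightarrow> h \<in> carrier G \<and> h \<noteq> \<one>"
proof
  assume *: "h \<in> carrier G \<and> h \<noteq> \<one>"
  then have "card (generate G {h}) = card (carrier G)"
    using generate_pow_card[of h] ord_eq_p order_G by (simp add: order_def)
  then have "generate G {h} = carrier G"
    using * generate_incl[of "{h}"] finite_carrier by (intro card_subset_eq) auto
  then show "is_generator G h" using * by (simp add: is_generator_def)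
next
  assume h: "is_generator G h"
  then have "ord h = p"
    using generate_pow_card[of h] order_G by (simp add: order_def is_generator_def)
  then have "h \<noteq> \<one>" using prime_p by (auto simp: prime_nat_iff)
  then show "h \<in> carrier G \<and> h \<noteq> \<one>" using h by (simp add: is_generator_def)
qed

lemma generator_carrier: "is_generator G h \<Longrightarrow> h \<in> carrier G"
  by (simp add: is_generator_iff)

lemma ord_generator: "is_generator G h \<Longrightarrow> ord h = p"
  by (simp add: is_generator_iff ord_eq_p)

lemma generator_pow_eq_one_iff:
  fixes n :: nat
  shows "is_generator G h \<Longrightarrow> h [^] n = \<one> \<longleftrightarrow> p dvd n"
  by (simp add: generator_carrier ord_generator pow_eq_id)

lemma generator_pow_eq_iff:
  fixes m n :: nat
  assumes "is_generator G h"
  shows "h [^] m = h [^] n \<longleftrightarrow> int p dvd int m - int n"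
  using int_pow_eq[OF generator_carrier[OF assms], of "int n" "int m"]
  by (auto simp: ord_generator[OF assms] int_pow_int)

lemma coord_pow:
  assumes h: "is_generator G h" and n: "1 \<le> n" "n \<le> p"
  shows "coord G h (h [^] n) = n"
  unfolding coord_def ord_generator[OF h]
proof (rule the_equality)
  fix m assume m: "m \<in> {1..p} \<and> h [^] n = h [^] m"
  moreover have "inj_on (\<lambda>k. h [^] k) {1..p}"
    using ord_inj'[OF generator_carrier[OF h]] by (simp only: ord_generator[OF h])
  ultimately show "m = n" using n by (metis inj_onD atLeastAtMost_iff)
qed (use n in auto)

lemma generator_power:
  assumes h: "is_generator G h" and x: "x \<in> carrier G"
  obtains n where "1 \<le> n" "n \<le> p" "x = h [^] n"
proof -
  have "x \<in> generate G {h}" using assms by (simp add: is_generator_def)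
  then obtain k :: nat where k: "x = h [^] k"
    using generate_pow_on_finite_carrier[OF finite_carrier generator_carrier[OF h]] by auto
  have p: "0 < p" using prime_p by (rule prime_gt_0_nat)
  show ?thesis
  proof (cases "p dvd k")
    case True
    then show ?thesis
      using that[of p] p k generator_pow_eq_one_iff[OF h, of k] generator_pow_eq_one_iff[OF h, of p]
      by auto
  next
    case False
    have "x = h [^] (k mod p)"
      unfolding k generator_pow_eq_iff[OF h] by (simp add: zmod_int minus_mod_eq_mult_div)
    moreover have "1 \<le> k mod p" using False by (simp add: Suc_le_eq mod_greater_zero_iff_not_dvd)
    ultimately show ?thesis using that[of "k mod p"] p by (simp add: less_imp_le)
  qed
qed

lemma coord_props:
  assumes h: "is_generator G h" and x: "x \<in> carrier G"
  shows "1 \<le> coord G h x" "coord G h x \<le> p" "x = h [^] coord G h x"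
proof -
  obtain n where "1 \<le> n" "n \<le> p" "x = h [^] n" using generator_power[OF assms] .
  then show "1 \<le> coord G h x" "coord G h x \<le> p" "x = h [^] coord G h x"
    using coord_pow[OF h] by auto
qed

lemma seq_sum_empty: "seq_sum G {#} = \<one>"
  by (simp add: seq_sum_def)

lemma seq_sum_add_mset:
  assumes x: "x \<in> carrier G" and T: "set_mset T \<subseteq> carrier G"
  shows "seq_sum G (add_mset x T) = x \<otimes> seq_sum G T"
proof (cases "x \<in># T")
  case True
  have "seq_sum G (add_mset x T)
      = finprod G (\<lambda>g. g [^] count (add_mset x T) g) (insert x (set_mset T - {x}))"
    using True by (simp add: seq_sum_def insert_absorb)
  also have "\<dots> = x [^] Suc (count T x) \<otimes>
      finprod G (\<lambda>g. g [^] count (add_mset x T) g) (set_mset T - {x})"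
    using x T by (subst finprod_insert) (auto simp del: nat_pow_Suc)
  also have "finprod G (\<lambda>g. g [^] count (add_mset x T) g) (set_mset T - {x})
      = finprod G (\<lambda>g. g [^] count T g) (set_mset T - {x})"
    using T by (intro finprod_cong') auto
  also have "x [^] Suc (count T x) \<otimes> \<dots> =
      x \<otimes> (x [^] count T x \<otimes> finprod G (\<lambda>g. g [^] count T g) (set_mset T - {x}))"
  proof -
    have "finprod G (\<lambda>g. g [^] count T g) (set_mset T - {x}) \<in> carrier G"
      using T by (intro finprod_closed) auto
    then show ?thesis using x nat_pow_Suc2[OF x] by (simp add: m_assoc del: nat_pow_Suc)
  qed
  also have "x [^] count T x \<otimes> finprod G (\<lambda>g. g [^] count T g) (set_mset T - {x})
      = finprod G (\<lambda>g. g [^] count T g) (insert x (set_mset T - {x}))"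
    using x T by (subst finprod_insert) auto
  also have "\<dots> = seq_sum G T" using True by (simp add: seq_sum_def insert_absorb)
  finally show ?thesis .
next
  case False
  have "seq_sum G (add_mset x T) =
      x [^] (1::nat) \<otimes> finprod G (\<lambda>g. g [^] count (add_mset x T) g) (set_mset T)"
    unfolding seq_sum_def set_mset_add_mset_insert
    using x T False by (subst finprod_insert) (auto simp: not_in_iff)
  also have "finprod G (\<lambda>g. g [^] count (add_mset x T) g) (set_mset T) = seq_sum G T"
    unfolding seq_sum_def using T False by (intro finprod_cong') auto
  finally show ?thesis using x by simp
qed

lemma seq_sum_eq_pow:
  assumes h: "is_generator G h" and T: "set_mset T \<subseteq> carrier G"
  shows "seq_sum G T = h [^] (\<Sum>x\<in>#T. coord G h x)"
  using T
proof (induction T)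
  case empty
  then show ?case by (simp add: seq_sum_empty)
next
  case (add x T)
  then have "seq_sum G (add_mset x T) = h [^] coord G h x \<otimes> h [^] (\<Sum>x\<in>#T. coord G h x)"
    using coord_props(3)[OF h, of x] by (simp add: seq_sum_add_mset)
  then show ?case using generator_carrier[OF h] by (simp add: nat_pow_mult)
qed

lemma zero_sum_iff:
  assumes "is_generator G h" "set_mset T \<subseteq> carrier G"
  shows "zero_sum G T \<longleftrightarrow> p dvd (\<Sum>x\<in>#T. coord G h x)"
  by (simp add: zero_sum_def seq_sum_eq_pow[OF assms] generator_pow_eq_one_iff[OF assms(1)])

lemma exists_generator: "\<exists>h. is_generator G h"
proof -
  have "1 < card (carrier G)" using prime_gt_1_nat[OF prime_p] order_G by (simp add: order_def)
  then have "\<not> carrier G \<subseteq> {\<one>}" using card_mono[of "{\<one>}" "carrier G"] by auto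
  then show ?thesis by (auto simp: is_generator_iff)
qed

lemma coord_inv:
  assumes h: "is_generator G h" and x: "x \<in> carrier G" "x \<noteq> \<one>"
  shows "coord G (inv h) x = p - coord G h x"
proof -
  let ?n = "coord G h x"
  have h': "is_generator G (inv h)" using h by (auto simp: is_generator_iff)
  have n: "1 \<le> ?n" "?n \<le> p" "x = h [^] ?n" using coord_props[OF h x(1)] by auto
  have "?n \<noteq> p" using n(3) x(2) generator_pow_eq_one_iff[OF h, of p] by auto
  have hc: "h \<in> carrier G" using generator_carrier[OF h] .
  have "h [^] ?n \<otimes> h [^] (p - ?n) = h [^] p"
    using n(2) hc by (simp add: nat_pow_mult)
  also have "\<dots> = \<one>" using generator_pow_eq_one_iff[OF h, of p] by simp
  finally have "h [^] ?n \<otimes> h [^] (p - ?n) = \<one>" .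
  then have "inv (h [^] (p - ?n)) = h [^] ?n"
    using hc by (intro inv_equality) auto
  then have "x = inv h [^] (p - ?n)" using n(3) hc by (simp add: nat_pow_inv)
  then show ?thesis using coord_pow[OF h', of "p - ?n"] n \<open>?n \<noteq> p\<close> by simp
qed

text \<open>
  The sum of the coordinates with respect to \<open>h\<close> is a positive multiple \<open>n p\<close> of \<open>p\<close>. A coordinate
  \<open>i\<close> becomes \<open>p - i\<close> when \<open>h\<close> is replaced by its inverse, because the neutral element does not
  occur in a minimal zero-sum sequence of length 5. So the inverse has the sum \<open>(5 - n) p\<close>, and one
  of \<open>n\<close> and \<open>5 - n\<close> is at most 2.
\<close>

lemma seq_index_eq:
  assumes S: "minimal_zero_sum G S" and size: "size S = 5"
  shows "seq_index G S = (if \<exists>h. is_generator G h \<and> (\<Sum>x\<in>#S. coord G h x) = p then 1 else 2)"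
proof -
  let ?s = "\<lambda>h. \<Sum>x\<in>#S. coord G h x"
  let ?N = "{norm_wrt G h S | h. is_generator G h}"
  have SG: "set_mset S \<subseteq> carrier G" and zs: "zero_sum G S"
    and min: "\<And>T. T \<subset># S \<Longrightarrow> T \<noteq> {#} \<Longrightarrow> \<not> zero_sum G T"
    using S by (auto simp: minimal_zero_sum_def sequence_over_def)
  have p: "0 < p" using prime_p by (rule prime_gt_0_nat)
  have no_one: "\<one> \<notin># S"
  proof
    assume "\<one> \<in># S"
    then have "{#\<one>#} \<subset># S" using size by (auto simp: subset_mset_def)
    moreover have "zero_sum G {#\<one>#}" by (simp add: zero_sum_def seq_sum_add_mset seq_sum_empty)
    ultimately show False using min by auto
  qed
  have norm: "\<exists>n::nat. 1 \<le> n \<and> ?s h = n * p \<and> norm_wrt G h S = n" if h: "is_generator G h" for h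
  proof -
    obtain n where n: "?s h = n * p"
      using zs zero_sum_iff[OF h SG] by (metis dvd_def mult.commute)
    have "?s h \<noteq> 0"
      using SG coord_props(1)[OF h] size by (cases S) (auto simp: Suc_le_eq)
    then have "1 \<le> n" using n by (cases n) auto
    then show ?thesis using n p by (auto simp: norm_wrt_def ord_generator[OF h])
  qed
  have inv_sum: "?s h + ?s (inv h) = 5 * p" if h: "is_generator G h" for h
  proof -
    have "?s h + ?s (inv h) = (\<Sum>x\<in>#S. coord G h x + coord G (inv h) x)"
      by (simp add: sum_mset.distrib)
    also have "\<dots> = (\<Sum>x\<in>#S. p)"
    proof (rule arg_cong[of _ _ sum_mset], rule image_mset_cong)
      fix x assume "x \<in># S"
      then have "x \<in> carrier G" "x \<noteq> \<one>" using SG no_one by auto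
      then show "coord G h x + coord G (inv h) x = p"
        using coord_inv[OF h, of x] coord_props(2)[OF h, of x] by simp
    qed
    also have "\<dots> = 5 * p" using size by simp
    finally show ?thesis .
  qed
  have fin: "finite ?N" using finite_carrier by (auto simp: is_generator_iff)
  have ge1: "r = 1 \<or> 2 \<le> r" if "r \<in> ?N" for r
  proof -
    obtain h where "is_generator G h" "r = norm_wrt G h S" using \<open>r \<in> ?N\<close> by blast
    then obtain n :: nat where "1 \<le> n" "r = n" using norm by blast
    then show ?thesis by (cases "n = 1") auto
  qed
  have one_iff: "1 \<in> ?N \<longleftrightarrow> (\<exists>h. is_generator G h \<and> ?s h = p)"
  proof -
    have "1 = real n / real p \<longleftrightarrow> n = p" for n using p by auto
    then have "1 = norm_wrt G h S \<longleftrightarrow> ?s h = p" if "is_generator G h" for h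
      unfolding norm_wrt_def ord_generator[OF that] by blast
    moreover have "1 \<in> ?N \<longleftrightarrow> (\<exists>h. 1 = norm_wrt G h S \<and> is_generator G h)"
      by (rule mem_Collect_eq)
    ultimately show ?thesis by blast
  qed
  obtain h where h: "is_generator G h" using exists_generator by auto
  have h': "is_generator G (inv h)" using h by (auto simp: is_generator_iff)
  obtain n m :: nat where nm: "?s h = n * p" "norm_wrt G h S = n"
    "?s (inv h) = m * p" "norm_wrt G (inv h) S = m" using norm[OF h] norm[OF h'] by blast
  then have "(n + m) * p = 5 * p" using inv_sum[OF h] by (simp add: distrib_right)
  then have "n + m = 5" using p by simp
  then have "norm_wrt G h S \<le> 2 \<or> norm_wrt G (inv h) S \<le> 2" using nm by auto
  then have small: "\<exists>r \<in> ?N. r \<le> 2" using h h' by blast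
  show ?thesis
  proof (cases "1 \<in> ?N")
    case True
    moreover have "1 \<le> r" if "r \<in> ?N" for r using ge1[OF that] by auto
    ultimately have "Min ?N = 1" using fin by (intro Min_eqI)
    then show ?thesis using True one_iff by (simp add: seq_index_def)
  next
    case False
    have ge2: "2 \<le> r" if "r \<in> ?N" for r
    proof -
      have "r \<noteq> 1" using that False by blast
      then show ?thesis using ge1[OF that] by simp
    qed
    obtain r where r: "r \<in> ?N" "r \<le> 2" using small by blast
    then have "r = 2" using ge2[OF r(1)] by simp
    then have "2 \<in> ?N" using r(1) by blast
    with fin ge2 have "Min ?N = 2" by (intro Min_eqI)
    moreover have "\<not> (\<exists>h. is_generator G h \<and> ?s h = p)" using False one_iff by blast
    ultimately show ?thesis by (simp only: seq_index_def if_False)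
  qed
qed

text \<open>
  Passing from a generator \<open>g\<close> to its \<open>u\<close>-th root multiplies all coordinates by \<open>u\<close>.
\<close>

lemma coord_of_root:
  fixes u n :: nat
  assumes h: "is_generator G h" and g: "g = h [^] u" and n: "g [^] n \<noteq> \<one>"
  shows "coord G h (g [^] n) = (u * n) mod p"
proof -
  have gn: "g [^] n = h [^] (u * n)" using g generator_carrier[OF h] by (simp add: nat_pow_pow)
  have "0 < (u * n) mod p"
    using n generator_pow_eq_one_iff[OF h, of "u * n"] unfolding gn
    by (simp add: mod_greater_zero_iff_not_dvd)
  moreover have "h [^] (u * n) = h [^] ((u * n) mod p)"
    unfolding generator_pow_eq_iff[OF h] by (simp add: zmod_int minus_mod_eq_mult_div)
  moreover have "(u * n) mod p \<le> p" using prime_gt_0_nat[OF prime_p] by simp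
  ultimately show ?thesis unfolding gn using coord_pow[OF h, of "(u * n) mod p"] by simp
qed

lemma generator_root:
  fixes u :: nat
  assumes g: "is_generator G g" and u: "0 < u" "u < p"
  obtains h where "is_generator G h" "g = h [^] u"
proof -
  have gc: "g \<in> carrier G" using generator_carrier[OF g] .
  have "\<not> p dvd u" using u by (auto dest: dvd_imp_le)
  then have "is_generator G (g [^] u)"
    using generator_pow_eq_one_iff[OF g, of u] gc by (simp add: is_generator_iff)
  then obtain t where t: "g = (g [^] u) [^] (t::nat)" using generator_power[of "g [^] u" g] gc by metis
  have "g = (g [^] t) [^] u" using t gc by (simp add: nat_pow_pow mult.commute)
  moreover have "g [^] t \<noteq> \<one>"
  proof
    assume "g [^] t = \<one>"
    then have "g = \<one>" using \<open>g = (g [^] t) [^] u\<close> by simp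
    then show False using g by (simp add: is_generator_iff)
  qed
  ultimately show ?thesis using that[of "g [^] t"] gc by (simp add: is_generator_iff)
qed

lemma repeated_term:
  assumes S: "set_mset S \<subseteq> carrier G" "size S = 5" and mult: "2 \<le> max_mult G S"
  obtains g a b c where "S = {#g, g, a, b, c#}"
proof -
  have "Max (count S ` carrier G) \<in> count S ` carrier G"
    using finite_carrier by (intro Max_in) auto
  then obtain g where g: "2 \<le> count S g" using mult by (auto simp: max_mult_def)
  then have "{#g, g#} \<subseteq># S" by (auto simp: subseteq_mset_def)
  then obtain T where T: "S = {#g, g#} + T" by (auto simp: subset_mset.le_iff_add)
  then have "size T = Suc 2" using S(2) by simp
  then obtain a T' where a: "T = add_mset a T'" "size T' = Suc 1"
    using size_eq_Suc_imp_eq_union[of T 2] by auto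
  then obtain b T'' where b: "T' = add_mset b T''" "size T'' = Suc 0"
    using size_eq_Suc_imp_eq_union[of T' 1] by auto
  then obtain c where "T'' = {#c#}"
    using size_eq_Suc_imp_eq_union[of T'' 0] by auto
  then have "T = {#a, b, c#}" using a(1) b(1) by simp
  with T have "S = {#g, g, a, b, c#}" by simp
  then show ?thesis by (rule that)
qed

text \<open>
  With respect to \<open>g\<close> the proper subsequences \<open>a\<close>, \<open>g a\<close> and \<open>g\<^sup>2 a\<close> have the coordinate sums
  \<open>n\<close>, \<open>n + 1\<close> and \<open>n + 2\<close>, where \<open>n\<close> is the coordinate of \<open>a\<close>. None of these is divisible by
  \<open>p\<close>, which excludes \<open>n = p, p - 1, p - 2\<close>.
\<close>

lemma minimal_zero_sum_coords:
  assumes S: "minimal_zero_sum G {#g, g, a, b, c#}" and p: "3 < p"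
  shows "is_generator G g" "1 \<le> coord G g a" "coord G g a \<le> p - 3"
    "p dvd 2 + coord G g a + coord G g b + coord G g c"
proof -
  have SG: "{g, a, b, c} \<subseteq> carrier G" and zs: "zero_sum G {#g, g, a, b, c#}"
    and min: "\<And>T. T \<subset># {#g, g, a, b, c#} \<Longrightarrow> T \<noteq> {#} \<Longrightarrow> \<not> zero_sum G T"
    using S by (auto simp: minimal_zero_sum_def sequence_over_def)
  have sub: "{#g#} \<subset># {#g, g, a, b, c#}" "{#a#} \<subset># {#g, g, a, b, c#}"
    "{#g, a#} \<subset># {#g, g, a, b, c#}" "{#g, g, a#} \<subset># {#g, g, a, b, c#}"
    by (auto simp: subset_mset_def subseteq_mset_def)
  have "g \<noteq> \<one>"
    using min[OF sub(1)] SG by (auto simp: zero_sum_def seq_sum_add_mset seq_sum_empty)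
  then show g: "is_generator G g" using SG by (simp add: is_generator_iff)
  have "coord G g g = 1"
    using coord_pow[OF g, of 1] generator_carrier[OF g] p by simp
  then have dvd: "p dvd 2 + coord G g a + coord G g b + coord G g c"
    and nd: "\<not> p dvd coord G g a" "\<not> p dvd coord G g a + 1" "\<not> p dvd coord G g a + 2"
    using zs min[OF sub(2)] min[OF sub(3)] min[OF sub(4)] SG
    by (simp_all add: zero_sum_iff[OF g] add_ac)
  show "p dvd 2 + coord G g a + coord G g b + coord G g c" by (fact dvd)
  show "1 \<le> coord G g a" using coord_props(1)[OF g] SG by simp
  have "coord G g a \<le> p" using coord_props(2)[OF g] SG by simp
  moreover have "coord G g a \<noteq> p" "coord G g a + 1 \<noteq> p" "coord G g a + 2 \<noteq> p"
    using nd by auto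
  ultimately show "coord G g a \<le> p - 3" by linarith
qed

end


section \<open>Sequences of length five with a repeated term\<close>

theorem theorem1p2:
  fixes G :: "('a, 'b) monoid_scheme" and p :: nat and S :: "'a multiset"
  assumes "Factorial_Ring.prime p" and "p \<ge> 31"
    and "group G" and "cyclic_group G" and "order G = p"
    and "minimal_zero_sum G S"
    and "size S = 5"
    and "max_mult G S \<ge> 2"
  shows "seq_index G S \<in> {1, 2} \<and>
    (seq_index G S = 2 \<longleftrightarrow>
      (\<exists>g \<in> carrier G. S = {# g, g, g [^]\<^bsub>G\<^esub> ((p - 1) div 2), g [^]\<^bsub>G\<^esub> ((p + 3) div 2),
                             g [^]\<^bsub>G\<^esub> (p - 3) #}))"
proof -
  interpret group G by fact
  interpret comm_group G using assms(4) cyclic_imp_abelian_group by blast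
  interpret prime_order_group G p using assms(1,5) by unfold_locales
  have p: "0 < p" "odd p"
    using assms(1,2) prime_odd_nat[of p] by auto
  have SG: "set_mset S \<subseteq> carrier G"
    using assms(6) by (simp add: minimal_zero_sum_def sequence_over_def)
  let ?special = "\<exists>g \<in> carrier G. S = {# g, g, g [^]\<^bsub>G\<^esub> ((p - 1) div 2), g [^]\<^bsub>G\<^esub> ((p + 3) div 2),
                             g [^]\<^bsub>G\<^esub> (p - 3) #}"
  let ?unit = "\<exists>h. is_generator G h \<and> (\<Sum>x\<in>#S. coord G h x) = p"
  have "\<not> ?unit" if special: ?special
  proof
    assume ?unit
    then obtain h where h: "is_generator G h" and sum: "(\<Sum>x\<in>#S. coord G h x) = p" by blast
    obtain g where S: "S = {# g, g, g [^]\<^bsub>G\<^esub> ((p - 1) div 2), g [^]\<^bsub>G\<^esub> ((p + 3) div 2),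
                             g [^]\<^bsub>G\<^esub> (p - 3) #}" using special by blast
    let ?u = "coord G h g"
    have pos: "0 < coord G h x" if "x \<in># S" for x
      using coord_props(1)[OF h, of x] that SG by auto
    have cong: "int p dvd int (coord G h (g [^]\<^bsub>G\<^esub> n)) - int ?u * int n" for n :: nat
    proof -
      have g: "g \<in> carrier G" using SG S by simp
      have "h [^]\<^bsub>G\<^esub> coord G h (g [^]\<^bsub>G\<^esub> n) = g [^]\<^bsub>G\<^esub> n"
        using coord_props(3)[OF h, of "g [^]\<^bsub>G\<^esub> n"] g by simp
      also have "\<dots> = (h [^]\<^bsub>G\<^esub> ?u) [^]\<^bsub>G\<^esub> n" using coord_props(3)[OF h g] by simp
      also have "\<dots> = h [^]\<^bsub>G\<^esub> (?u * n)" using generator_carrier[OF h] by (simp add: nat_pow_pow)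
      finally show ?thesis unfolding generator_pow_eq_iff[OF h] by simp
    qed
    show False
    proof (rule exceptional_no_unit_sum)
      show "2 * int ?u + int (coord G h (g [^]\<^bsub>G\<^esub> ((p - 1) div 2))) +
          int (coord G h (g [^]\<^bsub>G\<^esub> ((p + 3) div 2))) + int (coord G h (g [^]\<^bsub>G\<^esub> (p - 3))) = int p"
        using sum by (simp add: S)
      show "int p dvd int (coord G h (g [^]\<^bsub>G\<^esub> ((p - 1) div 2))) - int ?u * ((int p - 1) div 2)"
        using cong[of "(p - 1) div 2"] assms(2) by (simp add: zdiv_int of_nat_diff)
      show "int p dvd int (coord G h (g [^]\<^bsub>G\<^esub> (p - 3))) - int ?u * (int p - 3)"
        using cong[of "p - 3"] assms(2) by (simp add: of_nat_diff)
    qed (use p(2) pos in \<open>auto simp: S\<close>)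
  qed
  moreover have ?special if no_unit: "\<not> ?unit"
  proof -
    obtain g a b c where S: "S = {#g, g, a, b, c#}"
      using repeated_term SG assms(7,8) .
    have S': "minimal_zero_sum G {#g, g, a, b, c#}" "minimal_zero_sum G {#g, g, b, a, c#}"
      "minimal_zero_sum G {#g, g, c, a, b#}"
      using assms(6) S by (simp_all add: add_mset_commute)
    have g: "is_generator G g" using minimal_zero_sum_coords(1)[OF S'(1)] assms(2) by simp
    let ?a = "coord G g a" and ?b = "coord G g b" and ?c = "coord G g c"
    have abc: "a = g [^]\<^bsub>G\<^esub> ?a" "b = g [^]\<^bsub>G\<^esub> ?b" "c = g [^]\<^bsub>G\<^esub> ?c"
      using coord_props(3)[OF g] SG S by simp_all
    have bounds: "1 \<le> ?a" "?a \<le> p - 3" "1 \<le> ?b" "?b \<le> p - 3" "1 \<le> ?c" "?c \<le> p - 3"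
      and dvd: "p dvd 2 + ?a + ?b + ?c"
      using minimal_zero_sum_coords(2-4)[OF S'(1)] minimal_zero_sum_coords(2,3)[OF S'(2)]
        minimal_zero_sum_coords(2,3)[OF S'(3)] assms(2) by simp_all
    have "{#?a, ?b, ?c#} = {#(p - 1) div 2, (p + 3) div 2, p - 3#}"
    proof (rule ccontr)
      assume "{#?a, ?b, ?c#} \<noteq> {#(p - 1) div 2, (p + 3) div 2, p - 3#}"
      then obtain u where u: "0 < u" "2 * u + (u * ?a) mod p + (u * ?b) mod p + (u * ?c) mod p = p"
        using unit_sum_exists[OF assms(1,2) bounds dvd] by blast
      then have "u < p" by linarith
      then obtain h where h: "is_generator G h" "g = h [^]\<^bsub>G\<^esub> u" using generator_root[OF g u(1)] by blast
      have "coord G h (g [^]\<^bsub>G\<^esub> n) = (u * n) mod p" if "1 \<le> n" "n \<le> p - 3" for n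
      proof (rule coord_of_root[OF h])
        have "\<not> p dvd n" using that p(1) assms(2) by (auto dest!: dvd_imp_le)
        then show "g [^]\<^bsub>G\<^esub> n \<noteq> \<one>\<^bsub>G\<^esub>" by (simp add: generator_pow_eq_one_iff[OF g])
      qed
      then have "coord G h a = (u * ?a) mod p" "coord G h b = (u * ?b) mod p" "coord G h c = (u * ?c) mod p"
        using bounds abc by metis+
      moreover have "coord G h g = u" using coord_pow[OF h(1), of u] h(2) u(1) \<open>u < p\<close> by simp
      ultimately have "(\<Sum>x\<in>#S. coord G h x) = p" using u(2) by (simp add: S)
      then show False using no_unit h(1) by blast
    qed
    then have "image_mset (\<lambda>n. g [^]\<^bsub>G\<^esub> n) {#?a, ?b, ?c#} =
        image_mset (\<lambda>n. g [^]\<^bsub>G\<^esub> n) {#(p - 1) div 2, (p + 3) div 2, p - 3#}" by (rule arg_cong)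
    then have "{#a, b, c#} = {#g [^]\<^bsub>G\<^esub> ((p - 1) div 2), g [^]\<^bsub>G\<^esub> ((p + 3) div 2), g [^]\<^bsub>G\<^esub> (p - 3)#}"
      by (simp flip: abc)
    then show ?thesis using S generator_carrier[OF g] by (intro bexI[of _ g]) simp_all
  qed
  ultimately show ?thesis using seq_index_eq[OF assms(6,7)] by auto
qed

end
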